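(* Let $s,k$ be positive integers. The nice order ideals of $P(s,k)$ are in one-to-one correspondence with the order ideals of $P'(s,k)$ that do not contain two elements $(a,0)$ and $(a',-1)$ with $|a-a'|\le k/2$.
   Context: Define $L(s,k)=\bigcup_{j\ge0}\{2i-1+2sj : i\in\mathbb{Z},\ jk+1\le i\le\lfloor s/2\rfloor\}$, $R(s,k)=\bigcup_{j\ge0}\{2i-1+2sj : i\in\mathbb{Z},\ jk+\lceil(s+k)/2\rceil+1\le i\le s\}$, and $P(s,k)=L(s,k)\cup R(s,k)$ with the partial order generated by: $y$ covers $x$ iff $y=x+2s+2t$ for some integer $0\le t\le k$. An order ideal $I$ of $P(s,k)$ (a downward closed subset) is nice if there are no $h_1,h_2\in I$ with $h_1+h_2\in\{2s,2s+2,\ldots,2s+2k\}$. Define $L'(s,k)=\bigcup_{j\ge0}\{(i-\tfrac{k}{2}j,\ j): i\in\mathbb{Z},\ jk+1\le i\le\lfloor s/2\rfloor\}$ and $R'(s,k)=\bigcup_{j\ge0}\{(s+1-i+\tfrac{k}{2}(j+1),\ -j-1): i\in\mathbb{Z},\ jk+\lceil(s+k)/2\rceil+1\le i\le s\}$, and $P'(s,k)=L'(s,k)\cup R'(s,k)$ with the partial order generated by the cover relations: for $(a,b),(a',b')\in L'(s,k)$, $(a,b)$ covers $(a',b')$ iff $|a-a'|\le k/2$ and $b=b'+1$; for $(a,b),(a',b')\in R'(s,k)$, $(a,b)$ covers $(a',b')$ iff $|a-a'|\le k/2$ and $b=b'-1$ (no element of $L'$ is comparable to an element of $R'$). *)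

theory Defs
  imports Complex_Main
begin

section \<open>Posets generated by covering relations, and order ideals\<close>

text \<open>Orders are relations in the sense of \<^theory>\<open>HOL.Order_Relation\<close>: a pair \<open>(x, y)\<close> in
  the relation means that \<open>x\<close> is below or equal to \<open>y\<close>; likewise a pair \<open>(x, y)\<close> in a covering
  relation means that \<open>y\<close> covers \<open>x\<close>.\<close>

definition generated_order :: "'a set \<Rightarrow> 'a rel \<Rightarrow> 'a rel" where
  "generated_order A C = (C \<inter> A \<times> A)\<^sup>* \<inter> A \<times> A"

definition order_ideal :: "'a set \<Rightarrow> 'a rel \<Rightarrow> 'a set \<Rightarrow> bool" where
  "order_ideal A r I \<longleftrightarrow> I \<subseteq> A \<and> (\<forall>y\<in>I. \<forall>x\<in>A. (x, y) \<in> r \<longrightarrow> x \<in> I)"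

section \<open>The poset \<open>P(s,k)\<close>\<close>

definition setL :: "nat \<Rightarrow> nat \<Rightarrow> int set" where
  "setL s k = (\<Union>j::nat. {2 * i - 1 + 2 * int s * int j | i :: int.
     int j * int k + 1 \<le> i \<and> i \<le> \<lfloor>real s / 2\<rfloor>})"

definition setR :: "nat \<Rightarrow> nat \<Rightarrow> int set" where
  "setR s k = (\<Union>j::nat. {2 * i - 1 + 2 * int s * int j | i :: int.
     int j * int k + \<lceil>(real s + real k) / 2\<rceil> + 1 \<le> i \<and> i \<le> int s})"

definition setP :: "nat \<Rightarrow> nat \<Rightarrow> int set" where
  "setP s k = setL s k \<union> setR s k"

definition coverP :: "nat \<Rightarrow> nat \<Rightarrow> int rel" where
  "coverP s k = {(x, y). x \<in> setP s k \<and> y \<in> setP s k \<and>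
     (\<exists>t::int. 0 \<le> t \<and> t \<le> int k \<and> y = x + 2 * int s + 2 * t)}"

definition orderP :: "nat \<Rightarrow> nat \<Rightarrow> int rel" where
  "orderP s k = generated_order (setP s k) (coverP s k)"

text \<open>The elements \<open>h1\<close> and \<open>h2\<close> are not required to be distinct.\<close>

definition nice_order_ideal :: "nat \<Rightarrow> nat \<Rightarrow> int set \<Rightarrow> bool" where
  "nice_order_ideal s k I \<longleftrightarrow> order_ideal (setP s k) (orderP s k) I \<and>
     \<not> (\<exists>h1\<in>I. \<exists>h2\<in>I. h1 + h2 \<in> {2 * int s + 2 * t | t :: int. 0 \<le> t \<and> t \<le> int k})"

section \<open>The poset \<open>P'(s,k)\<close>\<close>

text \<open>First coordinates may be half-integers, hence the type of points is \<open>real \<times> int\<close>.\<close>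

definition setL' :: "nat \<Rightarrow> nat \<Rightarrow> (real \<times> int) set" where
  "setL' s k = (\<Union>j::nat. {(real_of_int i - real k / 2 * real j, int j) | i :: int.
     int j * int k + 1 \<le> i \<and> i \<le> \<lfloor>real s / 2\<rfloor>})"

definition setR' :: "nat \<Rightarrow> nat \<Rightarrow> (real \<times> int) set" where
  "setR' s k = (\<Union>j::nat. {(real s + 1 - real_of_int i + real k / 2 * (real j + 1), - int j - 1)
     | i :: int. int j * int k + \<lceil>(real s + real k) / 2\<rceil> + 1 \<le> i \<and> i \<le> int s})"

text \<open>\<open>P'(s,k)\<close> is the union of the two parts; they are disjoint, since second coordinates are
  nonnegative on \<open>L'(s,k)\<close> and negative on \<open>R'(s,k)\<close>.\<close>

definition setP' :: "nat \<Rightarrow> nat \<Rightarrow> (real \<times> int) set" where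
  "setP' s k = setL' s k \<union> setR' s k"

definition coverP' :: "nat \<Rightarrow> nat \<Rightarrow> (real \<times> int) rel" where
  "coverP' s k =
     {((a', b'), (a, b)). (a', b') \<in> setL' s k \<and> (a, b) \<in> setL' s k \<and>
        \<bar>a - a'\<bar> \<le> real k / 2 \<and> b = b' + 1} \<union>
     {((a', b'), (a, b)). (a', b') \<in> setR' s k \<and> (a, b) \<in> setR' s k \<and>
        \<bar>a - a'\<bar> \<le> real k / 2 \<and> b = b' - 1}"

definition orderP' :: "nat \<Rightarrow> nat \<Rightarrow> (real \<times> int) rel" where
  "orderP' s k = generated_order (setP' s k) (coverP' s k)"

section \<open>The generated relations are partial orders\<close>

lemma partial_order_on_generated_order:
  fixes f :: "'a \<Rightarrow> int"
  assumes mono: "\<And>x y. (x, y) \<in> C \<Longrightarrow> f x < f y"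
  shows "partial_order_on A (generated_order A C)"
proof -
  let ?D = "C \<inter> A \<times> A"
  have less: "x = y \<or> f x < f y" if "(x, y) \<in> ?D\<^sup>*" for x y
    using that by (induction rule: rtrancl_induct) (use mono in force)+
  have "antisym (generated_order A C)"
  proof (rule antisymI)
    fix x y assume "(x, y) \<in> generated_order A C" "(y, x) \<in> generated_order A C"
    then have "(x, y) \<in> ?D\<^sup>*" "(y, x) \<in> ?D\<^sup>*"
      by (simp_all add: generated_order_def)
    from this[THEN less] show "x = y" by auto
  qed
  moreover have "trans (generated_order A C)"
    by (auto simp: generated_order_def intro!: transI)
  moreover have "refl_on A (generated_order A C)" "generated_order A C \<subseteq> A \<times> A"
    by (auto simp: generated_order_def refl_on_def)
  ultimately show ?thesis
    by (simp add: partial_order_on_def preorder_on_def)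
qed

lemma partial_order_on_orderP:
  assumes "s > 0"
  shows "partial_order_on (setP s k) (orderP s k)"
  unfolding orderP_def
  by (rule partial_order_on_generated_order[where f = "\<lambda>x. x"])
     (use assms in \<open>auto simp: coverP_def\<close>)

lemma partial_order_on_orderP': "partial_order_on (setP' s k) (orderP' s k)"
  unfolding orderP'_def
  by (rule partial_order_on_generated_order[where f = "\<lambda>p. \<bar>snd p\<bar>"])
     (auto simp: coverP'_def setL'_def setR'_def)

end

theory Submission
  imports Defs
begin

text \<open>Both posets are parametrised by the same set of index pairs \<open>(i, j)\<close>, and in the indices
  both covering relations say that \<open>j\<close> grows by one and \<open>i\<close> grows by at most \<open>k\<close>, the pairs with
  \<open>2 i \<le> s\<close> (the left part) and those with \<open>2 i > s\<close> (the right part) never being related: the bound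
  \<open>i \<ge> j k + 1\<close> excludes every carry modulo \<open>s\<close>. The same bound shows that two elements of \<open>P(s,k)\<close> can
  have a sum in \<open>{2 s, \<dots>, 2 s + 2 k}\<close> only if both have \<open>j = 0\<close> and they lie in different parts.\<close>

section \<open>Order ideals of a generated order and their transport along injective maps\<close>

text \<open>Closure under single covering steps propagates down any chain by induction from its top
  element. Comparing two posets therefore reduces to comparing their covering relations.\<close>

lemma order_ideal_generated_order_iff:
  "order_ideal A (generated_order A C) I \<longleftrightarrow>
     I \<subseteq> A \<and> (\<forall>(x, y)\<in>C \<inter> A \<times> A. y \<in> I \<longrightarrow> x \<in> I)"
proof
  assume "order_ideal A (generated_order A C) I"
  moreover have "(x, y) \<in> generated_order A C" if "(x, y) \<in> C \<inter> A \<times> A" for x y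
    using that by (auto simp: generated_order_def)
  ultimately show "I \<subseteq> A \<and> (\<forall>(x, y)\<in>C \<inter> A \<times> A. y \<in> I \<longrightarrow> x \<in> I)"
    unfolding order_ideal_def by blast
next
  assume I: "I \<subseteq> A \<and> (\<forall>(x, y)\<in>C \<inter> A \<times> A. y \<in> I \<longrightarrow> x \<in> I)"
  have "x \<in> I" if "(x, y) \<in> (C \<inter> A \<times> A)\<^sup>*" "y \<in> I" for x y
    using that by (induction rule: converse_rtrancl_induct) (use I in blast)+
  with I show "order_ideal A (generated_order A C) I"
    by (auto simp: order_ideal_def generated_order_def)
qed

lemma order_ideal_image_iff:
  assumes "inj_on f A" "C \<subseteq> A \<times> A" "U \<subseteq> A"
  shows "order_ideal (f ` A) (generated_order (f ` A) (map_prod f f ` C)) (f ` U) \<longleftrightarrow>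
    order_ideal A (generated_order A C) U"
proof -
  have mem: "f x \<in> f ` U \<longleftrightarrow> x \<in> U" if "x \<in> A" for x
    using assms(1,3) that by (simp add: inj_on_image_mem_iff)
  have "C \<inter> A \<times> A = C" "map_prod f f ` C \<inter> f ` A \<times> f ` A = map_prod f f ` C"
    using assms(2) by auto
  then have "order_ideal (f ` A) (generated_order (f ` A) (map_prod f f ` C)) (f ` U) \<longleftrightarrow>
      (\<forall>(x, y)\<in>C. f y \<in> f ` U \<longrightarrow> f x \<in> f ` U)"
    using assms(3) by (simp add: order_ideal_generated_order_iff image_mono case_prod_beta)
  also have "\<dots> \<longleftrightarrow> (\<forall>(x, y)\<in>C. y \<in> U \<longrightarrow> x \<in> U)"
    using assms(2) mem by blast
  also have "\<dots> \<longleftrightarrow> order_ideal A (generated_order A C) U"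
    using assms(3) \<open>C \<inter> A \<times> A = C\<close> by (simp add: order_ideal_generated_order_iff)
  finally show ?thesis .
qed

text \<open>\<open>Q\<close> is an arbitrary property of subsets of the image and is pulled back
  along \<open>f\<close>; it is instantiated by the two kinds of ideals to be counted.\<close>

lemma bij_betw_image_subsets:
  assumes "inj_on f A"
  shows "bij_betw (image f) {U. U \<subseteq> A \<and> Q (f ` U)} {V. V \<subseteq> f ` A \<and> Q V}"
  unfolding bij_betw_def
proof
  show "inj_on (image f) {U. U \<subseteq> A \<and> Q (f ` U)}"
    using assms by (intro inj_onI) (auto simp: inj_on_image_eq_iff)
  show "image f ` {U. U \<subseteq> A \<and> Q (f ` U)} = {V. V \<subseteq> f ` A \<and> Q V}"
    by (fastforce simp: subset_image_iff)
qed

section \<open>Index pairs and the two parametrisations\<close>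

text \<open>In the second alternative the condition \<open>i \<ge> j k + \<lceil>(s + k) / 2\<rceil> + 1\<close>
  is doubled to avoid the ceiling.\<close>

definition index_set :: "nat \<Rightarrow> nat \<Rightarrow> (int \<times> int) set" where
  "index_set s k = {(i, j). 0 \<le> j \<and> i \<le> int s \<and>
     (j * int k + 1 \<le> i \<and> 2 * i \<le> int s \<or> 2 * (j * int k) + int s + int k + 2 \<le> 2 * i)}"

definition index_cover :: "nat \<Rightarrow> nat \<Rightarrow> (int \<times> int) rel" where
  "index_cover s k = {((i, j), (i', j')). (i, j) \<in> index_set s k \<and> (i', j') \<in> index_set s k \<and>
     (2 * i \<le> int s \<longleftrightarrow> 2 * i' \<le> int s) \<and> j' = j + 1 \<and> i \<le> i' \<and> i' \<le> i + int k}"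

definition pointP :: "nat \<Rightarrow> int \<times> int \<Rightarrow> int" where
  "pointP s = (\<lambda>(i, j). 2 * i - 1 + 2 * int s * j)"

text \<open>One test on \<open>i\<close> selects the formula: left indices satisfy
  \<open>2 * i \<le> int s\<close>, and right indices violate it by
  \<open>right_bound\<close>.\<close>

definition pointP' :: "nat \<Rightarrow> nat \<Rightarrow> int \<times> int \<Rightarrow> real \<times> int" where
  "pointP' s k = (\<lambda>(i, j). if 2 * i \<le> int s then (real_of_int i - real k / 2 * real_of_int j, j)
     else (real s + 1 - real_of_int i + real k / 2 * (real_of_int j + 1), - j - 1))"

text \<open>The right alternative is stronger than \<open>j * int k + 1 \<le> i\<close>, so this
  bound is uniform. Moreover \<open>i - 1\<close> is always a remainder modulo
  \<open>s\<close>.\<close>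

lemma index_set_bounds:
  assumes "(i, j) \<in> index_set s k"
  shows "0 \<le> j" "j * int k + 1 \<le> i" "1 \<le> i" "i \<le> int s"
proof -
  have "0 \<le> j" using assms by (simp add: index_set_def)
  moreover from this have "0 \<le> j * int k" by simp
  ultimately show "0 \<le> j" "j * int k + 1 \<le> i" "1 \<le> i" "i \<le> int s"
    using assms unfolding index_set_def mem_Collect_eq case_prod_conv by linarith+
qed

lemma le_floor_half_iff: "i \<le> \<lfloor>real s / 2\<rfloor> \<longleftrightarrow> 2 * i \<le> int s"
  by (simp add: le_floor_iff) linarith

lemma ceiling_half_le_iff:
  "c + \<lceil>(real s + real k) / 2\<rceil> + 1 \<le> i \<longleftrightarrow> 2 * c + int s + int k + 2 \<le> 2 * i"
proof -
  have "c + \<lceil>(real s + real k) / 2\<rceil> + 1 \<le> i \<longleftrightarrow> \<lceil>(real s + real k) / 2\<rceil> \<le> i - c - 1"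
    by linarith
  also have "\<dots> \<longleftrightarrow> real s + real k \<le> 2 * real_of_int (i - c - 1)"
    unfolding ceiling_le_iff by (simp only: pos_divide_le_eq zero_less_numeral mult.commute)
  also have "\<dots> \<longleftrightarrow> real_of_int (2 * c + int s + int k + 2) \<le> real_of_int (2 * i)"
    by (simp add: algebra_simps)
  also have "\<dots> \<longleftrightarrow> 2 * c + int s + int k + 2 \<le> 2 * i"
    by (rule of_int_le_iff)
  finally show ?thesis .
qed

lemma index_set_left_iff:
  assumes "2 * i \<le> int s"
  shows "(i, j) \<in> index_set s k \<longleftrightarrow> 0 \<le> j \<and> j * int k + 1 \<le> i"
proof -
  have "0 \<le> j * int k" if "0 \<le> j" using that by simp
  then show ?thesis
    using assms unfolding index_set_def mem_Collect_eq case_prod_conv by linarith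
qed

lemma index_set_right_iff:
  assumes "\<not> 2 * i \<le> int s"
  shows "(i, j) \<in> index_set s k \<longleftrightarrow>
    0 \<le> j \<and> i \<le> int s \<and> 2 * (j * int k) + int s + int k + 2 \<le> 2 * i"
  using assms by (auto simp: index_set_def)

lemma right_bound:
  assumes "0 \<le> j" "2 * (j * int k) + int s + int k + 2 \<le> 2 * i"
  shows "\<not> 2 * i \<le> int s"
proof -
  have "0 \<le> j * int k" using assms(1) by simp
  with assms(2) show ?thesis by linarith
qed

section \<open>The sets of points as injective images of the index set\<close>

lemma setL_eq: "setL s k = pointP s ` {(i, j)\<in>index_set s k. 2 * i \<le> int s}"
proof (intro equalityI subsetI)
  fix x assume "x \<in> setL s k"
  then obtain i and j :: nat where
    "x = 2 * i - 1 + 2 * int s * int j" "int j * int k + 1 \<le> i" "2 * i \<le> int s"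
    by (auto simp: setL_def le_floor_half_iff)
  then show "x \<in> pointP s ` {(i, j)\<in>index_set s k. 2 * i \<le> int s}"
    by (intro image_eqI[where x = "(i, int j)"]) (auto simp: pointP_def index_set_left_iff)
next
  fix x assume "x \<in> pointP s ` {(i, j)\<in>index_set s k. 2 * i \<le> int s}"
  then obtain i j where "x = 2 * i - 1 + 2 * int s * j" "0 \<le> j" "j * int k + 1 \<le> i" "2 * i \<le> int s"
    by (auto simp: pointP_def index_set_left_iff)
  then show "x \<in> setL s k"
    unfolding setL_def le_floor_half_iff by (intro UN_I[where a = "nat j"]) auto
qed

lemma setR_eq: "setR s k = pointP s ` {(i, j)\<in>index_set s k. \<not> 2 * i \<le> int s}"
proof (intro equalityI subsetI)
  fix x assume "x \<in> setR s k"
  then obtain i and j :: nat where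
    x: "x = 2 * i - 1 + 2 * int s * int j"
      "2 * (int j * int k) + int s + int k + 2 \<le> 2 * i" "i \<le> int s"
    unfolding setR_def ceiling_half_le_iff by auto
  moreover from x have "\<not> 2 * i \<le> int s" by (intro right_bound) auto
  ultimately show "x \<in> pointP s ` {(i, j)\<in>index_set s k. \<not> 2 * i \<le> int s}"
    by (intro image_eqI[where x = "(i, int j)"]) (auto simp: pointP_def index_set_right_iff)
next
  fix x assume "x \<in> pointP s ` {(i, j)\<in>index_set s k. \<not> 2 * i \<le> int s}"
  then obtain i j where "x = 2 * i - 1 + 2 * int s * j" "0 \<le> j"
    "2 * (j * int k) + int s + int k + 2 \<le> 2 * i" "i \<le> int s"
    by (auto simp: pointP_def index_set_right_iff)
  then show "x \<in> setR s k"
    unfolding setR_def ceiling_half_le_iff by (intro UN_I[where a = "nat j"]) auto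
qed

lemma setL'_eq: "setL' s k = pointP' s k ` {(i, j)\<in>index_set s k. 2 * i \<le> int s}"
proof (intro equalityI subsetI)
  fix x assume "x \<in> setL' s k"
  then obtain i and j :: nat where
    "x = (real_of_int i - real k / 2 * real j, int j)" "int j * int k + 1 \<le> i" "2 * i \<le> int s"
    by (auto simp: setL'_def le_floor_half_iff)
  then show "x \<in> pointP' s k ` {(i, j)\<in>index_set s k. 2 * i \<le> int s}"
    by (intro image_eqI[where x = "(i, int j)"]) (auto simp: pointP'_def index_set_left_iff)
next
  fix x assume "x \<in> pointP' s k ` {(i, j)\<in>index_set s k. 2 * i \<le> int s}"
  then obtain i j where "x = (real_of_int i - real k / 2 * real_of_int j, j)"
    "0 \<le> j" "j * int k + 1 \<le> i" "2 * i \<le> int s"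
    by (auto simp: pointP'_def index_set_left_iff)
  then show "x \<in> setL' s k"
    unfolding setL'_def le_floor_half_iff by (intro UN_I[where a = "nat j"]) auto
qed

lemma setR'_eq: "setR' s k = pointP' s k ` {(i, j)\<in>index_set s k. \<not> 2 * i \<le> int s}"
proof (intro equalityI subsetI)
  fix x assume "x \<in> setR' s k"
  then obtain i and j :: nat where
    x: "x = (real s + 1 - real_of_int i + real k / 2 * (real j + 1), - int j - 1)"
      "2 * (int j * int k) + int s + int k + 2 \<le> 2 * i" "i \<le> int s"
    unfolding setR'_def ceiling_half_le_iff by auto
  moreover from x have "\<not> 2 * i \<le> int s" by (intro right_bound) auto
  ultimately show "x \<in> pointP' s k ` {(i, j)\<in>index_set s k. \<not> 2 * i \<le> int s}"
    by (intro image_eqI[where x = "(i, int j)"]) (auto simp: pointP'_def index_set_right_iff)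
next
  fix x assume "x \<in> pointP' s k ` {(i, j)\<in>index_set s k. \<not> 2 * i \<le> int s}"
  then obtain i j where
    "x = (real s + 1 - real_of_int i + real k / 2 * (real_of_int j + 1), - j - 1)" "0 \<le> j"
    "2 * (j * int k) + int s + int k + 2 \<le> 2 * i" "i \<le> int s"
    by (auto simp: pointP'_def index_set_right_iff)
  then show "x \<in> setR' s k"
    unfolding setR'_def ceiling_half_le_iff by (intro UN_I[where a = "nat j"]) auto
qed

lemma setP_eq: "setP s k = pointP s ` index_set s k"
  unfolding setP_def setL_eq setR_eq by blast

lemma setP'_eq: "setP' s k = pointP' s k ` index_set s k"
  unfolding setP'_def setL'_eq setR'_eq by blast

lemma inj_on_pointP: "inj_on (pointP s) (index_set s k)"
proof (rule inj_onI, clarify)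
  fix i j i' j'
  assume ij: "(i, j) \<in> index_set s k" "(i', j') \<in> index_set s k"
    and "pointP s (i, j) = pointP s (i', j')"
  then have eq: "i - 1 + int s * j = i' - 1 + int s * j'" by (simp add: pointP_def)
  note bounds = index_set_bounds[OF ij(1)] index_set_bounds[OF ij(2)]
  \<comment> \<open>Division with remainder: \<open>0 \<le> i - 1 < int s\<close>, so
    \<open>j\<close> is the quotient.\<close>
  have "j = (i - 1 + int s * j) div int s" "j' = (i' - 1 + int s * j') div int s"
    using bounds by (auto simp: div_pos_pos_trivial)
  with eq have "j = j'" by metis
  with eq show "i = i' \<and> j = j'" by simp
qed

text \<open>As \<open>j\<close> is nonnegative, the sign of the second coordinate tells the branches
  apart; its value then gives \<open>j\<close>, and the first coordinate gives
  \<open>i\<close>.\<close>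

lemma inj_on_pointP': "inj_on (pointP' s k) (index_set s k)"
proof (rule inj_onI, clarify)
  fix i j i' j'
  assume ij: "(i, j) \<in> index_set s k" "(i', j') \<in> index_set s k"
    and "pointP' s k (i, j) = pointP' s k (i', j')"
  then show "i = i' \<and> j = j'"
    using ij[THEN index_set_bounds(1)] by (auto simp: pointP'_def split: if_splits)
qed

section \<open>The covering relations in terms of indices\<close>

lemma pointP_cover_iff:
  assumes ij: "(i, j) \<in> index_set s k" "(i', j') \<in> index_set s k"
  shows "(pointP s (i, j), pointP s (i', j')) \<in> coverP s k \<longleftrightarrow>
    ((i, j), (i', j')) \<in> index_cover s k"
proof -
  note b = index_set_bounds[OF ij(1)] index_set_bounds[OF ij(2)]
  have "(pointP s (i, j), pointP s (i', j')) \<in> coverP s k \<longleftrightarrow>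
      (\<exists>t. 0 \<le> t \<and> t \<le> int k \<and> i' + int s * j' = i + int s * j + int s + t)"
    using ij by (auto simp: coverP_def setP_eq) (auto simp: pointP_def intro!: exI)
  also have "\<dots> \<longleftrightarrow> j' = j + 1 \<and> i \<le> i' \<and> i' \<le> i + int k"
  proof
    assume "\<exists>t. 0 \<le> t \<and> t \<le> int k \<and> i' + int s * j' = i + int s * j + int s + t"
    then obtain t where t: "0 \<le> t" "t \<le> int k" "i' + int s * j' = i + int s * j + int s + t"
      by blast
    \<comment> \<open>Otherwise \<open>i' \<ge> i + int s + t > int s\<close>, beyond the range of
      \<open>i'\<close>.\<close>
    have "j' \<ge> j + 1"
    proof (rule ccontr)
      assume "\<not> j' \<ge> j + 1"
      then have "int s * j' \<le> int s * j" by (intro mult_left_mono) auto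
      with t b show False by linarith
    qed
    \<comment> \<open>Otherwise the equation leaves
      \<open>i' \<le> i - int s + t \<le> int k\<close>, whereas level at least 2 demands
      \<open>i' \<ge> 2 * int k + 1\<close>.\<close>
    moreover have "j' \<le> j + 1"
    proof (rule ccontr)
      assume "\<not> j' \<le> j + 1"
      then have "int s * j' \<ge> int s * (j + 2)" by (intro mult_left_mono) auto
      moreover have "j' * int k \<ge> 2 * int k"
        using \<open>\<not> j' \<le> j + 1\<close> b(1) by (intro mult_right_mono) auto
      ultimately show False using t b by (simp add: algebra_simps)
    qed
    ultimately have "j' = j + 1" by simp
    with t show "j' = j + 1 \<and> i \<le> i' \<and> i' \<le> i + int k" by (simp add: algebra_simps)
  next
    assume "j' = j + 1 \<and> i \<le> i' \<and> i' \<le> i + int k"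
    then show "\<exists>t. 0 \<le> t \<and> t \<le> int k \<and> i' + int s * j' = i + int s * j + int s + t"
      by (intro exI[where x = "i' - i"]) (simp add: algebra_simps)
  qed
  also have "\<dots> \<longleftrightarrow> ((i, j), (i', j')) \<in> index_cover s k"
  proof -
    \<comment> \<open>A step cannot cross from left to right: it gives
      \<open>2 * i' \<le> int s + 2 * int k\<close>, but a right index at level \<open>j + 1\<close>
      has \<open>2 * i' \<ge> int s + 3 * int k + 2\<close>. The reverse crossing contradicts
      \<open>i \<le> i'\<close>.\<close>
    have "2 * i \<le> int s \<longleftrightarrow> 2 * i' \<le> int s" if "j' = j + 1" "i \<le> i'" "i' \<le> i + int k"
    proof
      assume i: "2 * i \<le> int s"
      show "2 * i' \<le> int s"
      proof (rule ccontr)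
        assume "\<not> 2 * i' \<le> int s"
        then have "2 * (j * int k) + 2 * int k + int s + int k + 2 \<le> 2 * i'"
          using ij(2) that by (simp add: index_set_right_iff algebra_simps)
        moreover have "0 \<le> j * int k" using b(1) by simp
        ultimately show False using i that by linarith
      qed
    qed (use that in linarith)
    then show ?thesis using ij by (auto simp: index_cover_def)
  qed
  finally show ?thesis .
qed

lemma pointP'_mem_setL'_iff:
  assumes "(i, j) \<in> index_set s k"
  shows "pointP' s k (i, j) \<in> setL' s k \<longleftrightarrow> 2 * i \<le> int s"
  unfolding setL'_eq using inj_on_image_mem_iff[OF inj_on_pointP' assms] assms by auto

lemma pointP'_mem_setR'_iff:
  assumes "(i, j) \<in> index_set s k"
  shows "pointP' s k (i, j) \<in> setR' s k \<longleftrightarrow> \<not> 2 * i \<le> int s"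
  unfolding setR'_eq using inj_on_image_mem_iff[OF inj_on_pointP' assms] assms by auto

lemma pointP'_cover_iff:
  assumes ij: "(i, j) \<in> index_set s k" "(i', j') \<in> index_set s k"
  shows "(pointP' s k (i, j), pointP' s k (i', j')) \<in> coverP' s k \<longleftrightarrow>
    ((i, j), (i', j')) \<in> index_cover s k"
proof -
  define h where "h = real k / 2"
  \<comment> \<open>The interval from 0 to \<open>k\<close> has midpoint and radius
    \<open>k / 2\<close>. The shift by \<open>k / 2\<close> per level in \<open>pointP'\<close> thus
    turns the one-sided range of \<open>i' - i\<close> into a symmetric one.\<close>
  have half: "\<bar>of_int i' - of_int i - h\<bar> \<le> h \<longleftrightarrow> i \<le> i' \<and> i' \<le> i + int k"
    unfolding h_def by linarith
  have cover: "(p, q) \<in> coverP' s k \<longleftrightarrow> \<bar>fst q - fst p\<bar> \<le> h \<and>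
      (p \<in> setL' s k \<and> q \<in> setL' s k \<and> snd q = snd p + 1 \<or>
       p \<in> setR' s k \<and> q \<in> setR' s k \<and> snd q = snd p - 1)" for p q
    by (cases p; cases q) (auto simp: coverP'_def h_def)
  let ?p = "pointP' s k (i, j)" and ?q = "pointP' s k (i', j')"
  have adjacent: "?p \<in> setL' s k \<and> ?q \<in> setL' s k \<and> snd ?q = snd ?p + 1 \<or>
       ?p \<in> setR' s k \<and> ?q \<in> setR' s k \<and> snd ?q = snd ?p - 1 \<longleftrightarrow>
      j' = j + 1 \<and> (2 * i \<le> int s \<longleftrightarrow> 2 * i' \<le> int s)"
    unfolding pointP'_mem_setL'_iff[OF ij(1)] pointP'_mem_setL'_iff[OF ij(2)]
      pointP'_mem_setR'_iff[OF ij(1)] pointP'_mem_setR'_iff[OF ij(2)]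
    by (auto simp: pointP'_def)
  \<comment> \<open>The right part is drawn reflected, so the two sides differ only by a sign, which
    the absolute value removes.\<close>
  have "\<bar>fst ?q - fst ?p\<bar> = \<bar>of_int i' - of_int i - h\<bar>"
    if "j' = j + 1" "2 * i \<le> int s \<longleftrightarrow> 2 * i' \<le> int s"
  proof -
    have "fst ?q - fst ?p = (if 2 * i \<le> int s then of_int i' - of_int i - h
        else - (of_int i' - of_int i - h))"
      using that unfolding pointP'_def h_def[symmetric] by (simp add: algebra_simps)
    then show ?thesis by (cases "2 * i \<le> int s") (simp_all only: abs_minus_cancel if_True if_False)
  qed
  then show ?thesis
    unfolding cover adjacent using half ij by (auto simp: index_cover_def)
qed

lemma rel_eq_map_prod_image:
  assumes "R \<subseteq> f ` A \<times> f ` A" "C \<subseteq> A \<times> A"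
    and "\<And>x y. x \<in> A \<Longrightarrow> y \<in> A \<Longrightarrow> (f x, f y) \<in> R \<longleftrightarrow> (x, y) \<in> C"
  shows "R = map_prod f f ` C"
  using assms by (force simp: image_iff)

lemma index_cover_subset: "index_cover s k \<subseteq> index_set s k \<times> index_set s k"
  by (auto simp: index_cover_def)

lemma coverP_eq: "coverP s k = map_prod (pointP s) (pointP s) ` index_cover s k"
proof (rule rel_eq_map_prod_image[OF _ index_cover_subset])
  show "coverP s k \<subseteq> pointP s ` index_set s k \<times> pointP s ` index_set s k"
    by (auto simp: coverP_def simp flip: setP_eq)
qed (use pointP_cover_iff in auto)

lemma coverP'_eq: "coverP' s k = map_prod (pointP' s k) (pointP' s k) ` index_cover s k"
proof (rule rel_eq_map_prod_image[OF _ index_cover_subset])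
  show "coverP' s k \<subseteq> pointP' s k ` index_set s k \<times> pointP' s k ` index_set s k"
    by (auto simp: coverP'_def setP'_def simp flip: setP'_eq)
qed (use pointP'_cover_iff in auto)

text \<open>Each side is equivalent to \<open>U\<close> being an order ideal of the index set under
  \<open>index_cover s k\<close>.\<close>

lemma order_ideal_pointP_iff_pointP':
  assumes "U \<subseteq> index_set s k"
  shows "order_ideal (setP s k) (orderP s k) (pointP s ` U) \<longleftrightarrow>
    order_ideal (setP' s k) (orderP' s k) (pointP' s k ` U)"
  unfolding orderP_def orderP'_def setP_eq setP'_eq coverP_eq coverP'_eq
  by (simp add: order_ideal_image_iff inj_on_pointP inj_on_pointP' index_cover_subset assms)

section \<open>The forbidden pairs in terms of indices\<close>

text \<open>The bounds start at \<open>int s + 1\<close> because the equation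
  \<open>(2 * i - 1) + (2 * i' - 1) = 2 * int s + 2 * t\<close> means
  \<open>i + i' = int s + 1 + t\<close>.\<close>

definition index_conflict :: "nat \<Rightarrow> nat \<Rightarrow> (int \<times> int) set \<Rightarrow> bool" where
  "index_conflict s k U \<longleftrightarrow> (\<exists>i i'. (i, 0) \<in> U \<and> (i', 0) \<in> U \<and> 2 * i \<le> int s \<and> \<not> 2 * i' \<le> int s \<and>
     int s + 1 \<le> i + i' \<and> i + i' \<le> int s + 1 + int k)"

lemma pointP_sum_iff:
  assumes ij: "(i, j) \<in> index_set s k" "(i', j') \<in> index_set s k"
  shows "pointP s (i, j) + pointP s (i', j') \<in> {2 * int s + 2 * t | t :: int. 0 \<le> t \<and> t \<le> int k} \<longleftrightarrow>
    j = 0 \<and> j' = 0 \<and> \<not> (2 * i \<le> int s \<longleftrightarrow> 2 * i' \<le> int s) \<and>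
    int s + 1 \<le> i + i' \<and> i + i' \<le> int s + 1 + int k"
proof -
  note b = index_set_bounds[OF ij(1)] index_set_bounds[OF ij(2)]
  have sum: "pointP s (i, j) + pointP s (i', j') = 2 * (i + i' - 1 + int s * (j + j'))"
    by (simp add: pointP_def algebra_simps)
  have mem: "2 * c \<in> {2 * int s + 2 * t | t :: int. 0 \<le> t \<and> t \<le> int k} \<longleftrightarrow>
      int s \<le> c \<and> c \<le> int s + int k" for c :: int
    by (auto intro!: exI[where x = "c - int s"])
  show ?thesis
  proof (cases "j + j' = 0")
    case True
    then have j: "j = 0" "j' = 0" using b by auto
    \<comment> \<open>Two left indices have sum at most \<open>int s\<close>, which is too small;
      two right indices at level 0 have sum at least \<open>int s + int k + 2\<close>, which is too
      large. In particular no element conflicts with itself.\<close>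
    have "\<not> (2 * i \<le> int s \<longleftrightarrow> 2 * i' \<le> int s)"
      if "int s \<le> i + i' - 1" "i + i' - 1 \<le> int s + int k"
      using ij that j by (cases "2 * i \<le> int s"; cases "2 * i' \<le> int s")
        (auto simp: index_set_left_iff index_set_right_iff)
    then show ?thesis
      unfolding sum mem using j by auto
  next
    case False
    \<comment> \<open>Above level 0 the sum overshoots: adding the bounds
      \<open>j * int k + 1 \<le> i\<close> and \<open>j' * int k + 1 \<le> i'\<close> gives
      \<open>i + i' \<ge> int k + 2\<close>, hence half the sum of the points is at least
      \<open>int s + int k + 1\<close>.\<close>
    then have "int s * 1 \<le> int s * (j + j')" using b by (intro mult_left_mono) auto
    moreover have "1 * int k \<le> (j + j') * int k"
      using False b by (intro mult_right_mono) auto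
    then have "int k + 2 \<le> i + i'" using b(2,6) by (simp add: algebra_simps)
    ultimately show ?thesis
      unfolding sum mem using False by auto
  qed
qed

lemma pointP_conflict_iff:
  assumes "U \<subseteq> index_set s k"
  shows "(\<exists>h1\<in>pointP s ` U. \<exists>h2\<in>pointP s ` U.
      h1 + h2 \<in> {2 * int s + 2 * t | t :: int. 0 \<le> t \<and> t \<le> int k}) \<longleftrightarrow> index_conflict s k U"
    (is "?lhs \<longleftrightarrow> _")
proof -
  let ?R = "\<lambda>i j i' j'. j = 0 \<and> j' = 0 \<and> \<not> (2 * i \<le> int s \<longleftrightarrow> 2 * i' \<le> int s) \<and>
      int s + 1 \<le> i + i' \<and> i + i' \<le> int s + 1 + int k"
  have "?lhs \<longleftrightarrow> (\<exists>i j i' j'. (i, j) \<in> U \<and> (i', j') \<in> U \<and>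
      pointP s (i, j) + pointP s (i', j') \<in> {2 * int s + 2 * t | t :: int. 0 \<le> t \<and> t \<le> int k})"
    unfolding bex_simps by (simp only: Bex_def split_paired_Ex) blast
  also have "\<dots> \<longleftrightarrow> (\<exists>i j i' j'. (i, j) \<in> U \<and> (i', j') \<in> U \<and> ?R i j i' j')"
    by (intro ex_cong1 conj_cong refl) (use assms pointP_sum_iff in blast)
  \<comment> \<open>\<open>?R\<close> is symmetric in the two pairs, so the left one may be named
    first.\<close>
  also have "\<dots> \<longleftrightarrow> index_conflict s k U"
    unfolding index_conflict_def by (metis add.commute)
  finally show ?thesis .
qed

lemma pointP'_conflict_iff:
  assumes "U \<subseteq> index_set s k"
  shows "(\<exists>a a' :: real. (a, 0) \<in> pointP' s k ` U \<and> (a', -1) \<in> pointP' s k ` U \<and>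
      \<bar>a - a'\<bar> \<le> real k / 2) \<longleftrightarrow> index_conflict s k U"
proof -
  have j: "0 \<le> j" if "(i, j) \<in> U" for i j
    using assms that index_set_bounds(1) by blast
  \<comment> \<open>Since \<open>j \<ge> 0\<close>, the right branch has second coordinate at most
    -1 and the left branch at least 0. Hence 0 and -1 are exactly the two level-0 rows.\<close>
  have zero: "(a, 0) \<in> pointP' s k ` U \<longleftrightarrow> (\<exists>i. (i, 0) \<in> U \<and> 2 * i \<le> int s \<and> a = of_int i)" for a
    by (force simp: pointP'_def image_iff dest: j split: if_splits)
  have minus_one: "(a, -1) \<in> pointP' s k ` U \<longleftrightarrow>
      (\<exists>i. (i, 0) \<in> U \<and> \<not> 2 * i \<le> int s \<and> a = real s + 1 - of_int i + real k / 2)" for a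
    by (force simp: pointP'_def image_iff dest: j split: if_splits)
  \<comment> \<open>The difference is \<open>i + i' - s - 1 - k / 2\<close>, again a deviation from
    the midpoint of the interval from 0 to \<open>k\<close>.\<close>
  have "\<bar>of_int i - (real s + 1 - of_int i' + real k / 2)\<bar> \<le> real k / 2 \<longleftrightarrow>
      int s + 1 \<le> i + i' \<and> i + i' \<le> int s + 1 + int k" for i i' :: int
    by linarith
  then show ?thesis
    unfolding zero minus_one index_conflict_def by metis
qed

section \<open>Composing the two bijections through sets of indices\<close>

theorem theorem2p8:
  fixes s k :: nat
  assumes "s > 0" and "k > 0"
  shows "\<exists>f. bij_betw f
    {I. nice_order_ideal s k I}
    {J. order_ideal (setP' s k) (orderP' s k) J \<and>
        \<not> (\<exists>a a' :: real. (a, 0) \<in> J \<and> (a', -1) \<in> J \<and> \<bar>a - a'\<bar> \<le> real k / 2)}"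
    (is "\<exists>f. bij_betw f _ {J. ?Q J}")
proof -
  let ?X = "index_set s k"
  have "{I. nice_order_ideal s k I} = {I. I \<subseteq> pointP s ` ?X \<and> nice_order_ideal s k I}"
    by (auto simp: nice_order_ideal_def order_ideal_def setP_eq)
  then have P: "bij_betw (image (pointP s)) {U. U \<subseteq> ?X \<and> nice_order_ideal s k (pointP s ` U)}
      {I. nice_order_ideal s k I}"
    using bij_betw_image_subsets[OF inj_on_pointP] by metis
  have "{J. ?Q J} = {J. J \<subseteq> pointP' s k ` ?X \<and> ?Q J}"
    by (auto simp: order_ideal_def setP'_eq)
  then have P': "bij_betw (image (pointP' s k)) {U. U \<subseteq> ?X \<and> ?Q (pointP' s k ` U)} {J. ?Q J}"
    using bij_betw_image_subsets[OF inj_on_pointP', where Q = ?Q] by simp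
  \<comment> \<open>Both properties become the same statement about \<open>U\<close>: it is an ideal
    of indices without an \<open>index_conflict\<close>.\<close>
  have "nice_order_ideal s k (pointP s ` U) \<longleftrightarrow> ?Q (pointP' s k ` U)" if "U \<subseteq> ?X" for U
    unfolding nice_order_ideal_def order_ideal_pointP_iff_pointP'[OF that]
      pointP_conflict_iff[OF that] pointP'_conflict_iff[OF that] ..
  then have "{U. U \<subseteq> ?X \<and> nice_order_ideal s k (pointP s ` U)} =
      {U. U \<subseteq> ?X \<and> ?Q (pointP' s k ` U)}"
    by blast
  with P' have "bij_betw (image (pointP' s k))
      {U. U \<subseteq> ?X \<and> nice_order_ideal s k (pointP s ` U)} {J. ?Q J}"
    by (simp only:)
  \<comment> \<open>The witness takes an ideal back to its index set by the inverse of
    \<open>image (pointP s)\<close> and then forward by \<open>image (pointP' s k)\<close>.\<close>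
  from bij_betw_trans[OF bij_betw_inv_into[OF P] this] show ?thesis
    by blast
qed

end
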